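(* Let $(X,\|\cdot\|)$ be a Banach space, let $k\in[0,\infty)$ and $h\in[0,1)$, and let $T:X\to X$ be a $(k,h)$-enriched Bianchini mapping. Then: (i) $T$ has exactly one fixed point: $Fix(T)=\{p\}$ for some $p\in X$. Moreover, there exists $\lambda\in(0,1]$ such that for every $x_0\in X$ the sequence $\{x_n\}_{n=0}^\infty$ given by $$x_{n+1}=(1-\lambda)x_n+\lambda T x_n,\quad n\ge 0,$$ satisfies: (ii) $\{x_n\}$ converges to $p$ (in norm); (iii) the estimate $$\|x_{n+i-1}-p\|\le \frac{h^i}{1-h}\,\|x_n-x_{n-1}\|$$ holds for all integers $n\ge 1$ and $i\ge 1$.
   Context: $Fix(T)=\{x\in X: Tx=x\}$ denotes the set of fixed points of $T$. For a normed linear space $(X,\|\cdot\|)$, a mapping $T:X\to X$ is called a $(k,h)$-enriched Bianchini mapping, where $k\in[0,\infty)$ and $h\in[0,1)$, if $$\|k(x-y)+Tx-Ty\|\le h\max\left\{\|x-Tx\|,\|y-Ty\|\right\}\quad\text{for all }x,y\in X.$$ *)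

theory Defs
  imports Complex_Main
begin

definition Fix :: "('a \<Rightarrow> 'a) \<Rightarrow> 'a set" where
  "Fix T = {x. T x = x}"

definition enriched_Bianchini ::
    "real \<Rightarrow> real \<Rightarrow> ('a::real_normed_vector \<Rightarrow> 'a) \<Rightarrow> bool" where
  "enriched_Bianchini k h T \<longleftrightarrow>
     k \<in> {0..} \<and> h \<in> {0..<1} \<and>
     (\<forall>x y. norm (k *\<^sub>R (x - y) + T x - T y)
              \<le> h * max (norm (x - T x)) (norm (y - T y)))"

end

theory Submission
  imports Defs
begin

text \<open>
  Enrichment disappears under averaging. With \<open>l = 1 / (k + 1)\<close>, the averaged map
  \<open>S x = (1 - l) x + l T x\<close> satisfies \<open>S x - S y = l (k (x - y) + T x - T y)\<close> and
  \<open>x - S x = l (x - T x)\<close>, so it has the fixed points of \<open>T\<close> and is a Bianchini mapping in the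
  plain sense \<open>k = 0\<close>: the distance of \<open>S x\<close> and \<open>S y\<close> is at most \<open>h\<close> times the larger
  displacement (lemma \<open>averaged_Bianchini\<close>). The sequence of the theorem is the Picard iteration
  of \<open>S\<close>.

  For a Bianchini mapping everything is controlled by the displacement \<open>\<parallel>x - S x\<parallel>\<close>. It shrinks by
  the factor \<open>h\<close> at each step (\<open>Bianchini_displacement\<close>), so orbits are Cauchy, and their limits
  are fixed points (\<open>Bianchini_fixed_point\<close>). Comparing with a fixed point, whose own
  displacement vanishes, gives \<open>\<parallel>S x - p\<parallel> \<le> h \<parallel>x - S x\<parallel>\<close> (\<open>Bianchini_distance_to_fixed_point\<close>),
  hence uniqueness, and \<open>\<parallel>S\<^sup>i x - p\<parallel> \<le> h\<^sup>i \<parallel>x - S x\<parallel>\<close> for \<open>i \<ge> 1\<close>. As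
  \<open>1 / (1 - h) \<ge> 1\<close>, this implies the claimed estimate, and it contains the convergence of every
  orbit to \<open>p\<close>.
\<close>

lemma enriched_BianchiniD:
  assumes "enriched_Bianchini k h T"
  shows "0 \<le> k" "0 \<le> h" "h < 1"
    and "norm (k *\<^sub>R (x - y) + T x - T y) \<le> h * max (norm (x - T x)) (norm (y - T y))"
  using assms by (auto simp: enriched_Bianchini_def)

lemma BianchiniD:
  assumes "enriched_Bianchini 0 h S"
  shows "norm (S x - S y) \<le> h * max (norm (x - S x)) (norm (y - S y))"
  using enriched_BianchiniD(4)[OF assms] by simp

definition averaged :: "real \<Rightarrow> ('a::real_vector \<Rightarrow> 'a) \<Rightarrow> 'a \<Rightarrow> 'a" where
  "averaged l T x = (1 - l) *\<^sub>R x + l *\<^sub>R T x"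

lemma averaged_displacement: "x - averaged l T x = l *\<^sub>R (x - T x)"
  by (simp add: averaged_def algebra_simps)

lemma Fix_averaged:
  assumes "l \<noteq> 0"
  shows "Fix (averaged l T) = Fix T"
proof -
  have "averaged l T x = x \<longleftrightarrow> T x = x" for x
    using averaged_displacement[of x l T] assms by (metis eq_iff_diff_eq_0 scaleR_eq_0_iff)
  then show ?thesis
    by (simp add: Fix_def)
qed

text \<open>
  The choice of \<open>l\<close> makes \<open>1 - l = l k\<close>, so both sides of the enriched inequality for \<open>T\<close>,
  multiplied by \<open>l\<close>, are the two sides of the plain inequality for the averaged map.
\<close>

lemma averaged_Bianchini:
  assumes T: "enriched_Bianchini k h T"
  shows "enriched_Bianchini 0 h (averaged (1 / (k + 1)) T)"
proof -
  define l where "l = 1 / (k + 1)"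
  note k = enriched_BianchiniD(1)[OF T] and h = enriched_BianchiniD(2,3)[OF T]
  have l: "l > 0" "1 - l = l * k"
    using k by (simp_all add: l_def field_simps)
  have "norm (averaged l T x - averaged l T y)
      \<le> h * max (norm (x - averaged l T x)) (norm (y - averaged l T y))" for x y
  proof -
    have "averaged l T x - averaged l T y = l *\<^sub>R (k *\<^sub>R (x - y) + T x - T y)"
      by (simp add: averaged_def l(2) algebra_simps)
    then have "norm (averaged l T x - averaged l T y) = l * norm (k *\<^sub>R (x - y) + T x - T y)"
      using l(1) by simp
    also have "\<dots> \<le> l * (h * max (norm (x - T x)) (norm (y - T y)))"
      using l(1) enriched_BianchiniD(4)[OF T] by (intro mult_left_mono) auto
    also have "\<dots> = h * max (l * norm (x - T x)) (l * norm (y - T y))"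
      using l(1) by (simp add: max_def)
    also have "\<dots> = h * max (norm (x - averaged l T x)) (norm (y - averaged l T y))"
      using l(1) by (simp add: averaged_displacement)
    finally show ?thesis .
  qed
  then show ?thesis
    using h by (simp add: enriched_Bianchini_def l_def)
qed

text \<open>
  In the inequality for the pair \<open>x\<close>, \<open>S x\<close> the maximum may be the displacement of \<open>S x\<close>, which
  is also the left-hand side; as \<open>h < 1\<close>, it is then \<open>0\<close> and the claim holds trivially.
\<close>

lemma Bianchini_displacement:
  assumes S: "enriched_Bianchini 0 h S"
  shows "norm (S x - S (S x)) \<le> h * norm (x - S x)"
proof (cases "norm (S x - S (S x)) \<le> norm (x - S x)")
  case True
  then show ?thesis
    using BianchiniD[OF S, of x "S x"] by (simp add: max_def split: if_splits)
next
  case False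
  then have "norm (S x - S (S x)) \<le> h * norm (S x - S (S x))"
    using BianchiniD[OF S, of x "S x"] by (simp add: max_def)
  moreover have "h * norm (S x - S (S x)) < 1 * norm (S x - S (S x))"
  proof (rule mult_strict_right_mono)
    show "h < 1"
      by (rule enriched_BianchiniD(3)[OF S])
    show "0 < norm (S x - S (S x))"
      using False norm_ge_zero[of "x - S x"] by linarith
  qed
  ultimately show ?thesis
    by simp
qed

lemma Bianchini_iterate_displacement:
  assumes S: "enriched_Bianchini 0 h S"
  shows "norm ((S ^^ n) x - S ((S ^^ n) x)) \<le> h ^ n * norm (x - S x)"
proof (induction n)
  case (Suc n)
  have "norm ((S ^^ Suc n) x - S ((S ^^ Suc n) x)) \<le> h * norm ((S ^^ n) x - S ((S ^^ n) x))"
    using Bianchini_displacement[OF S] by simp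
  also have "\<dots> \<le> h * (h ^ n * norm (x - S x))"
    using Suc enriched_BianchiniD(2)[OF S] by (rule mult_left_mono)
  finally show ?case
    by (simp add: mult.assoc)
qed simp

lemma Bianchini_iterates_convergent:
  fixes S :: "'a::banach \<Rightarrow> 'a"
  assumes S: "enriched_Bianchini 0 h S"
  shows "convergent (\<lambda>n. (S ^^ n) x)"
proof -
  note h = enriched_BianchiniD(2,3)[OF S]
  have "summable (\<lambda>n. (S ^^ Suc n) x - (S ^^ n) x)"
  proof (rule summable_comparison_test)
    show "\<exists>N. \<forall>n\<ge>N. norm ((S ^^ Suc n) x - (S ^^ n) x) \<le> h ^ n * norm (x - S x)"
      using Bianchini_iterate_displacement[OF S] by (simp add: norm_minus_commute)
    show "summable (\<lambda>n. h ^ n * norm (x - S x))"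
      using h by (intro summable_mult2 summable_geometric) simp
  qed
  then have "convergent (\<lambda>n. \<Sum>i<n. (S ^^ Suc i) x - (S ^^ i) x)"
    by (simp only: summable_iff_convergent)
  then have "convergent (\<lambda>n. (S ^^ n) x - x)"
    by (simp only: sum_lessThan_telescope[of "\<lambda>n. (S ^^ n) x"] funpow_0)
  then show ?thesis
    by (simp only: convergent_diff_const_right_iff)
qed

text \<open>
  A Bianchini mapping need not be continuous, so the limit \<open>p\<close> of an orbit is not a fixed point
  for the usual reason. Instead, letting \<open>n\<close> tend to infinity in the inequality for the pair
  \<open>S\<^sup>n x\<close>, \<open>p\<close> bounds the displacement of \<open>p\<close> by \<open>h\<close> times itself.
\<close>

lemma Bianchini_fixed_point:
  fixes S :: "'a::banach \<Rightarrow> 'a"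
  assumes S: "enriched_Bianchini 0 h S"
  obtains p where "S p = p"
proof -
  define u where "u = (\<lambda>n. (S ^^ n) 0)"
  obtain p where p: "u \<longlonglongrightarrow> p"
    using Bianchini_iterates_convergent[OF S, of 0] by (auto simp: u_def convergent_def)
  have p': "(\<lambda>n. S (u n)) \<longlonglongrightarrow> p"
    using LIMSEQ_Suc[OF p] by (simp add: u_def)
  have "(\<lambda>n. norm (S (u n) - S p)) \<longlonglongrightarrow> norm (p - S p)"
    by (intro tendsto_intros p')
  moreover have "(\<lambda>n. h * max (norm (u n - S (u n))) (norm (p - S p)))
      \<longlonglongrightarrow> h * max (norm (p - p)) (norm (p - S p))"
    by (intro tendsto_intros tendsto_max p p')
  ultimately have "norm (p - S p) \<le> h * max (norm (p - p)) (norm (p - S p))"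
    using BianchiniD[OF S] by (intro LIMSEQ_le) auto
  then have "(1 - h) * norm (p - S p) \<le> 0"
    by (simp add: algebra_simps)
  then have "norm (p - S p) \<le> 0"
    using enriched_BianchiniD(3)[OF S] by (simp add: mult_le_0_iff)
  then show thesis
    by (intro that[of p]) simp
qed

lemma Bianchini_distance_to_fixed_point:
  assumes "enriched_Bianchini 0 h S" and "S p = p"
  shows "norm (S x - p) \<le> h * norm (x - S x)"
  using BianchiniD[OF assms(1), of x p] assms(2) by simp

lemma Bianchini_iterate_distance:
  assumes S: "enriched_Bianchini 0 h S" and p: "S p = p"
  shows "norm ((S ^^ Suc n) x - p) \<le> h ^ Suc n * norm (x - S x)"
proof -
  have "norm ((S ^^ Suc n) x - p) \<le> h * norm ((S ^^ n) x - S ((S ^^ n) x))"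
    using Bianchini_distance_to_fixed_point[OF S p] by simp
  also have "\<dots> \<le> h * (h ^ n * norm (x - S x))"
    using Bianchini_iterate_displacement[OF S] enriched_BianchiniD(2)[OF S]
    by (rule mult_left_mono)
  finally show ?thesis
    by (simp add: mult.assoc)
qed

lemma Bianchini_Fix:
  assumes S: "enriched_Bianchini 0 h S" and p: "S p = p"
  shows "Fix S = {p}"
proof -
  have "q = p" if "S q = q" for q
    using Bianchini_distance_to_fixed_point[OF S p, of q] that by simp
  with p show ?thesis
    unfolding Fix_def by blast
qed

lemma Bianchini_iterates_tendsto:
  assumes S: "enriched_Bianchini 0 h S" and p: "S p = p"
  shows "(\<lambda>n. (S ^^ n) x) \<longlonglongrightarrow> p"
proof -
  have "(\<lambda>n. h ^ n * norm (x - S x)) \<longlonglongrightarrow> 0"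
    using enriched_BianchiniD(2,3)[OF S] by (intro tendsto_mult_left_zero LIMSEQ_power_zero) simp
  then have "(\<lambda>n. h ^ Suc n * norm (x - S x)) \<longlonglongrightarrow> 0"
    by (rule LIMSEQ_Suc)
  then have "(\<lambda>n. (S ^^ Suc n) x - p) \<longlonglongrightarrow> 0"
  proof (rule tendsto_0_le[where K = 1], intro always_eventually allI)
    fix n
    show "norm ((S ^^ Suc n) x - p) \<le> norm (h ^ Suc n * norm (x - S x)) * 1"
      by (rule order_trans[OF Bianchini_iterate_distance[OF S p]]) simp
  qed
  then have "(\<lambda>n. (S ^^ Suc n) x) \<longlonglongrightarrow> p"
    by (rule LIM_zero_cancel)
  then show ?thesis
    by (rule LIMSEQ_imp_Suc)
qed

theorem theorem3:
  fixes T :: "'a::banach \<Rightarrow> 'a" and k h :: real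
  assumes "k \<in> {0..}" and "h \<in> {0..<1}"
    and "enriched_Bianchini k h T"
  shows "\<exists>p. Fix T = {p} \<and>
    (\<exists>l::real. l \<in> {0<..1} \<and>
      (\<forall>x0. \<forall>x :: nat \<Rightarrow> 'a.
         x 0 = x0 \<and> (\<forall>n. x (n + 1) = (1 - l) *\<^sub>R x n + l *\<^sub>R T (x n)) \<longrightarrow>
         x \<longlonglongrightarrow> p \<and>
         (\<forall>n\<ge>1. \<forall>i\<ge>1. norm (x (n + i - 1) - p) \<le> h ^ i / (1 - h) * norm (x n - x (n - 1)))))"
proof -
  define l where "l = 1 / (k + 1)"
  define S where "S = averaged l T"
  have l: "l \<in> {0<..1}"
    using assms(1) by (simp add: l_def)
  have S: "enriched_Bianchini 0 h S"
    using averaged_Bianchini[OF assms(3)] by (simp add: S_def l_def)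
  obtain p where p: "S p = p"
    using Bianchini_fixed_point[OF S] .
  have "Fix S = Fix T"
    unfolding S_def using l by (intro Fix_averaged) simp
  then have "Fix T = {p}"
    using Bianchini_Fix[OF S p] by (rule trans[OF sym])
  moreover have "x \<longlonglongrightarrow> p \<and>
      (\<forall>n\<ge>1. \<forall>i\<ge>1. norm (x (n + i - 1) - p) \<le> h ^ i / (1 - h) * norm (x n - x (n - 1)))"
    if step: "\<forall>n. x (n + 1) = (1 - l) *\<^sub>R x n + l *\<^sub>R T (x n)" for x :: "nat \<Rightarrow> 'a"
  proof -
    have x_Suc: "x (Suc n) = S (x n)" for n
      using step by (simp add: S_def averaged_def)
    have orbit: "x (m + n) = (S ^^ n) (x m)" for m n
      by (induction n) (simp_all add: x_Suc)
    have "(\<lambda>n. x (0 + n)) \<longlonglongrightarrow> p"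
      by (subst orbit) (rule Bianchini_iterates_tendsto[OF S p])
    then have "x \<longlonglongrightarrow> p"
      by simp
    moreover have "norm (x (n + i - 1) - p) \<le> h ^ i / (1 - h) * norm (x n - x (n - 1))"
      if ni: "n \<ge> 1" "i \<ge> 1" for n i
    proof -
      obtain m j where mj: "n = Suc m" "i = Suc j"
        using ni by (auto simp: Suc_le_eq gr0_conv_Suc)
      have "norm (x (n + i - 1) - p) = norm ((S ^^ i) (x m) - p)"
        by (simp only: mj orbit[symmetric]) simp
      also have "\<dots> \<le> h ^ i * norm (x m - S (x m))"
        unfolding mj by (rule Bianchini_iterate_distance[OF S p])
      also have "\<dots> = h ^ i * norm (x n - x (n - 1))"
        by (simp add: mj x_Suc norm_minus_commute)
      also have "\<dots> \<le> h ^ i / (1 - h) * norm (x n - x (n - 1))"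
        using assms(2) by (intro mult_right_mono) (auto simp: le_divide_eq mult_left_le)
      finally show ?thesis .
    qed
    ultimately show ?thesis
      by blast
  qed
  ultimately show ?thesis
    using l by blast
qed

end
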